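(* For every nonnegative integer $n$, $c\phi_{2,-1}(5n+4)\equiv 0 \pmod 5$.
   Context: $c\phi_{2,-1}(n)$ is defined by $\sum_{n\ge0}c\phi_{2,-1}(n)q^n=$ the coefficient of $z^{-1}$ in the formal product $\prod_{\lambda=0}^{\infty}(1+zq^{\lambda+1})^2(1+z^{-1}q^{\lambda})^2$. Equivalently, $c\phi_{2,-1}(n)$ counts two-rowed arrays (top row with $m_1$ entries, bottom row with $m_2$ entries, $m_1-m_2=-1$) of nonnegative integers each carrying one of 2 colors, with no colored integer repeated within a row, and of weight $m_1+(\text{sum of all entries})=n$. *)

theory Defs
  imports
    "HOL-Analysis.Analysis"
    "HOL-Computational_Algebra.Computational_Algebra"
    "HOL-Number_Theory.Cong"
begin

text \<open>
  The formal product lives in power series in \<open>q\<close> whose coefficients are Laurent series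
  in \<open>z\<close>. The factor for index 0 contains \<open>1 + z\<^sup>-\<^sup>1\<close>, so \<open>z\<close> has to be invertible in
  the coefficient ring. The infinite product is the limit in the \<open>q\<close>-adic topology.
\<close>

definition frob_factor :: "nat \<Rightarrow> int fls fps" where
  "frob_factor l =
     (1 + fps_const fls_X * fps_X ^ (l + 1))\<^sup>2 * (1 + fps_const fls_X_inv * fps_X ^ l)\<^sup>2"

definition frob_product :: "int fls fps" where
  "frob_product = (\<Prod>l. frob_factor l)"

definition cphi_2_neg1 :: "nat \<Rightarrow> int" where
  "cphi_2_neg1 n = fls_nth (fps_nth frob_product n) (-1)"

text \<open>The product converges, so the above is not about an unspecified value.\<close>

lemma frob_factor_eq: "\<exists>G. frob_factor l = 1 + fps_X ^ l * G"
proof -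
  have "frob_factor l = ((1 + fps_X ^ l * (fps_const fls_X * fps_X)) * (1 + fps_X ^ l * fps_const fls_X_inv))\<^sup>2"
    unfolding frob_factor_def power_mult_distrib power_add power_one_right
    by (simp only: mult.commute mult.left_commute mult.assoc)
  also have "\<exists>G. \<dots> = 1 + fps_X ^ l * G"
  proof -
    have "((1 + x * a) * (1 + x * b))\<^sup>2
        = 1 + x * ((a + b + x * a * b) * (2 + x * (a + b + x * a * b)))"
      for x a b :: "int fls fps"
      by algebra
    then show ?thesis by blast
  qed
  finally show ?thesis .
qed

lemma frob_partial_stable:
  assumes "m \<le> n"
  shows "fps_nth (\<Prod>l\<le>n. frob_factor l) m = fps_nth (\<Prod>l\<le>m. frob_factor l) m"
  using assms
proof (induction n rule: dec_induct)
  case base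
  show ?case by simp
next
  case (step n)
  obtain G where G: "frob_factor (Suc n) = 1 + fps_X ^ Suc n * G"
    using frob_factor_eq by blast
  have "(\<Prod>l\<le>Suc n. frob_factor l)
      = (\<Prod>l\<le>n. frob_factor l) + fps_X ^ Suc n * (G * (\<Prod>l\<le>n. frob_factor l))"
    unfolding prod.atMost_Suc G by (simp only: distrib_left mult_1_left mult_1_right ac_simps)
  moreover have "fps_nth (fps_X ^ Suc n * (G * (\<Prod>l\<le>n. frob_factor l))) m = 0"
    unfolding fps_X_power_mult_nth using step by simp
  ultimately show ?case
    using step by (simp del: prod.atMost_Suc power_Suc)
qed

lemma frob_factor_has_prod:
  "frob_factor has_prod Abs_fps (\<lambda>m. fps_nth (\<Prod>l\<le>m. frob_factor l) m)" (is "_ has_prod ?L")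
proof -
  have "(\<lambda>n. \<Prod>l\<le>n. frob_factor l) \<longlonglongrightarrow> ?L"
  proof (rule tendsto_fpsI)
    fix m
    show "\<forall>\<^sub>F n in sequentially. fps_nth (\<Prod>l\<le>n. frob_factor l) m = fps_nth ?L m"
      using eventually_ge_at_top[of m]
      by eventually_elim (simp only: fps_nth_Abs_fps, rule frob_partial_stable)
  qed
  moreover have "?L \<noteq> 0"
  proof
    assume "?L = 0"
    then have "fps_nth ?L 0 = 0" by (simp only: fps_zero_nth)
    then have "fps_nth (frob_factor 0) 0 = 0"
      by (simp only: fps_nth_Abs_fps prod.atMost_Suc atMost_0 prod.insert prod.empty
          finite.emptyI empty_iff not_False_eq_True mult_1_right)
    moreover have "fps_nth (frob_factor 0) 0 = (1 + fls_X_inv)\<^sup>2"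
      by (simp add: frob_factor_def power2_eq_square)
    ultimately have "(1 + fls_X_inv :: int fls) = 0"
      by (simp only: power_eq_0_iff)
    then have "fls_nth (1 + fls_X_inv :: int fls) 0 = fls_nth 0 0"
      by (rule arg_cong)
    then show False
      by (simp only: fls_plus_nth) simp
  qed
  ultimately show ?thesis
    unfolding has_prod_def raw_has_prod_def add_0_right by blast
qed

lemma cphi_2_neg1_eq_partial:
  "cphi_2_neg1 n = fls_nth (fps_nth (\<Prod>l\<le>n. frob_factor l) n) (-1)"
  unfolding cphi_2_neg1_def frob_product_def has_prod_unique[OF frob_factor_has_prod, symmetric]
  by simp

end

theory Submission
  imports Defs
begin

text \<open>
  By the Jacobi triple product, \<open>(q;q)\<^sub>\<infinity>\<^sup>2 \<Sum>c\<phi>(n)q\<^sup>n = \<Sum>\<^sub>a q^(a(a+1))\<close>, the sum being over all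
  integers. Multiply by Jacobi's \<open>2 (q;q)\<^sub>\<infinity>\<^sup>3 = \<Sum>\<^sub>b (-1)\<^sup>b (2b+1) q^(b(b+1)/2)\<close>.
  On the left, \<open>(q;q)\<^sub>\<infinity>\<^sup>5\<close> is modulo 5 a series in \<open>q\<^sup>5\<close> with constant term 1, so it does not
  affect divisibility by 5 along the residue class 4. On the right,
  \<open>a(a+1) + b(b+1)/2 \<equiv> 4 (mod 5)\<close> means \<open>(2b+1)\<^sup>2 + 2(2a+1)\<^sup>2 \<equiv> 0\<close>, and since \<open>-2\<close> is not a
  square modulo 5 this forces \<open>5 | 2b+1\<close>.

  Both identities are used in finite form (with \<open>q\<close>-binomial coefficients) modulo a power of \<open>q\<close>.
\<close>

unbundle no vec_syntax

section \<open>Gaussian binomials and finite q-Pochhammer products\<close>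

fun qbinom :: "'a::comm_ring_1 \<Rightarrow> nat \<Rightarrow> nat \<Rightarrow> 'a" where
  "qbinom q n 0 = 1"
| "qbinom q 0 (Suc k) = 0"
| "qbinom q (Suc n) (Suc k) = qbinom q n k + q ^ Suc k * qbinom q n (Suc k)"

definition qpoch :: "'a::comm_ring_1 \<Rightarrow> nat \<Rightarrow> 'a" where
  "qpoch q n = (\<Prod>i<n. 1 - q ^ Suc i)"

text \<open>The argument is an integer because the exponents of the triple product are centred;
  n(n+1) is never negative, so \<open>nat\<close> truncates nothing.\<close>

definition tri :: "int \<Rightarrow> nat" where
  "tri n = nat (n * (n + 1) div 2)"

lemma qbinom_eq_0: "n < k \<Longrightarrow> qbinom q n k = 0"
  by (induction q n k rule: qbinom.induct) auto

text \<open>Used to move Gaussian binomials into constant polynomials and into series with Laurent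
  coefficients.\<close>

lemma qbinom_hom:
  assumes "\<And>x y. h (x + y) = h x + h y" "\<And>x y. h (x * y) = h x * h y" "h 1 = 1" "h 0 = 0"
  shows "h (qbinom q n k) = qbinom (h q) n k"
proof -
  have "h (q ^ i) = h q ^ i" for i
    by (induction i) (simp_all add: assms)
  then show ?thesis
    by (induction q n k rule: qbinom.induct) (simp_all add: assms del: power_Suc)
qed

lemma qpoch_Suc: "qpoch q (Suc n) = qpoch q n * (1 - q ^ Suc n)"
  by (simp add: qpoch_def)

text \<open>The quotient formula for Gaussian binomials, free of division. Pascal's rule reduces it
  to (1 - q^i) + q^i (1 - q^j) = 1 - q^(i+j).\<close>

lemma qbinom_mult_qpoch: "qbinom q (i + j) i * qpoch q i * qpoch q j = qpoch q (i + j)"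
proof (induction "i + j" arbitrary: i j)
  case 0
  then show ?case by (simp add: qpoch_def)
next
  case (Suc n)
  show ?case
  proof (cases i)
    case 0
    then show ?thesis by (simp add: qpoch_def)
  next
    case i: (Suc i')
    have 1: "qbinom q n i' * qpoch q i' * qpoch q j = qpoch q n"
      using Suc.hyps(1)[of i' j] Suc.hyps(2) i by simp
    \<comment> \<open>The factor 1 - q^j lets this cover j = 0 too, where both sides vanish.\<close>
    have 2: "qbinom q n i * qpoch q i * qpoch q j = (1 - q ^ j) * qpoch q n"
    proof (cases j)
      case 0
      then show ?thesis using Suc.hyps(2) by (simp add: qbinom_eq_0)
    next
      case (Suc j')
      then have 3: "qpoch q n = qbinom q n i * qpoch q i * qpoch q j'"
        using Suc.hyps(1)[of i j'] \<open>Suc n = i + j\<close> by simp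
      then show ?thesis unfolding Suc qpoch_Suc 3 by (simp only: ac_simps)
    qed
    have "qbinom q (i + j) i * qpoch q i * qpoch q j
        = (1 - q ^ i) * (qbinom q n i' * qpoch q i' * qpoch q j)
          + q ^ i * (qbinom q n i * qpoch q i * qpoch q j)"
      unfolding Suc.hyps(2)[symmetric] unfolding i qbinom.simps qpoch_Suc
      by (simp only: algebra_simps)
    also have "\<dots> = qpoch q n * (1 - q ^ (i + j))"
      unfolding 1 2 power_add by (simp add: algebra_simps)
    finally show ?thesis
      unfolding Suc.hyps(2)[symmetric] qpoch_Suc by simp
  qed
qed

lemma double_tri: "2 * int (tri n) = n * (n + 1)"
proof -
  have "even (n * (n + 1))" by simp
  moreover have "0 \<le> n * (n + 1)"
    by (cases "n \<ge> 0") (auto intro: mult_nonpos_nonpos)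
  ultimately show ?thesis unfolding tri_def by auto
qed

lemma tri_of_nat_Suc: "tri (int (Suc j)) = tri (int j) + Suc j"
proof -
  have "2 * int (tri (int (Suc j))) = 2 * int (tri (int j) + Suc j)"
    unfolding of_nat_add distrib_left double_tri by (simp add: algebra_simps)
  then show ?thesis by (metis mult_cancel_left of_nat_eq_iff zero_neq_numeral)
qed

lemma tri_add_nat: "tri (int j - int k) + k = tri (int j - int (Suc k)) + j"
proof -
  have "2 * int (tri (int j - int k) + k) = 2 * int (tri (int j - int (Suc k)) + j)"
    unfolding of_nat_add distrib_left double_tri by (simp add: algebra_simps)
  then show ?thesis by (metis mult_cancel_left of_nat_eq_iff zero_neq_numeral)
qed

section \<open>The finite Jacobi triple product and its derivative\<close>

lemma sum_atMost_Suc_merge: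
  fixes a b :: "nat \<Rightarrow> 'a::comm_ring_1"
  assumes "b (Suc n) = 0"
  shows "(\<Sum>j\<le>n. a j) + (\<Sum>j\<le>n. b j) = b 0 + (\<Sum>j\<le>n. a j + b (Suc j))"
proof -
  have "(\<Sum>j\<le>n. b j) = (\<Sum>j\<le>Suc n. b j)" using assms by simp
  also have "\<dots> = b 0 + (\<Sum>j\<le>n. b (Suc j))" by (rule sum.atMost_Suc_shift)
  finally show ?thesis by (simp add: sum.distrib)
qed

text \<open>Splitting off the first factor replaces z by zq in the others, so the induction needs z
  arbitrary.\<close>

lemma qbinomial_theorem:
  "(\<Prod>i<m. 1 + z * q ^ Suc i) = (\<Sum>j\<le>m. qbinom q m j * q ^ tri (int j) * z ^ j)"
proof (induction m arbitrary: z)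
  case 0
  then show ?case by (simp add: tri_def)
next
  case (Suc m)
  let ?t = "\<lambda>j. qbinom q m j * q ^ tri (int j) * (z * q) ^ j"
  have "(\<Prod>i<Suc m. 1 + z * q ^ Suc i) = (1 + z * q) * (\<Prod>i<m. 1 + (z * q) * q ^ Suc i)"
    unfolding prod.lessThan_Suc_shift by (simp add: ac_simps)
  also have "\<dots> = (\<Sum>j\<le>m. z * q * ?t j) + (\<Sum>j\<le>m. ?t j)"
    unfolding Suc.IH distrib_right mult_1_left sum_distrib_left[symmetric] by (rule add.commute)
  also have "\<dots> = ?t 0 + (\<Sum>j\<le>m. z * q * ?t j + ?t (Suc j))"
    by (rule sum_atMost_Suc_merge) (simp add: qbinom_eq_0)
  also have "(\<Sum>j\<le>m. z * q * ?t j + ?t (Suc j))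
      = (\<Sum>j\<le>m. qbinom q (Suc m) (Suc j) * q ^ tri (int (Suc j)) * z ^ Suc j)"
    by (rule sum.cong[OF refl], unfold tri_of_nat_Suc)
      (simp add: algebra_simps power_add power_mult_distrib)
  finally show ?case
    unfolding sum.atMost_Suc_shift by (simp add: tri_def)
qed

text \<open>Using z + q^i in place of 1 + z^-1 q^i multiplies the usual product by z^k and avoids
  inverting z. Induction on k starts from the q-binomial theorem.\<close>

theorem finite_Jacobi_triple_product:
  "(\<Prod>i<m. 1 + z * q ^ Suc i) * (\<Prod>i<k. z + q ^ i)
     = (\<Sum>j\<le>m + k. qbinom q (m + k) j * q ^ tri (int j - int k) * z ^ j)"
proof (induction k)
  case 0
  then show ?case by (simp add: qbinomial_theorem del: power_Suc)
next
  case (Suc k)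
  let ?n = "m + k"
  let ?t = "\<lambda>j. qbinom q ?n j * q ^ tri (int j - int k) * z ^ j"
  have "(\<Prod>i<m. 1 + z * q ^ Suc i) * (\<Prod>i<Suc k. z + q ^ i) = (\<Sum>j\<le>?n. ?t j) * (z + q ^ k)"
    unfolding Suc.IH[symmetric] by (simp add: ac_simps)
  also have "\<dots> = (\<Sum>j\<le>?n. z * ?t j) + (\<Sum>j\<le>?n. q ^ k * ?t j)"
    unfolding distrib_left sum_distrib_right by (simp only: mult.commute)
  also have "\<dots> = q ^ k * ?t 0 + (\<Sum>j\<le>?n. z * ?t j + q ^ k * ?t (Suc j))"
    by (rule sum_atMost_Suc_merge) (simp add: qbinom_eq_0)
  also have "(\<Sum>j\<le>?n. z * ?t j + q ^ k * ?t (Suc j))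
      = (\<Sum>j\<le>?n. qbinom q (Suc ?n) (Suc j) * q ^ tri (int (Suc j) - int (Suc k)) * z ^ Suc j)"
  proof (rule sum.cong[OF refl])
    fix j
    have 1: "q ^ k * q ^ tri (int (Suc j) - int k)
        = q ^ tri (int (Suc j) - int (Suc k)) * q ^ Suc j"
      unfolding power_add[symmetric] using tri_add_nat[of "Suc j" k] by (simp add: add.commute)
    have 2: "tri (int j - int k) = tri (int (Suc j) - int (Suc k))" by simp
    have "z * ?t j + q ^ k * ?t (Suc j) = qbinom q ?n j * q ^ tri (int j - int k) * z ^ Suc j
        + qbinom q ?n (Suc j) * (q ^ k * q ^ tri (int (Suc j) - int k)) * z ^ Suc j"
      by (simp add: algebra_simps)
    also have "\<dots> = qbinom q (Suc ?n) (Suc j) * q ^ tri (int (Suc j) - int (Suc k)) * z ^ Suc j"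
      unfolding 1 2 qbinom.simps by (simp only: algebra_simps)
    finally show "z * ?t j + q ^ k * ?t (Suc j) = \<dots>" .
  qed
  also have "q ^ k * ?t 0 = qbinom q (Suc ?n) 0 * q ^ tri (int 0 - int (Suc k)) * z ^ 0"
    using tri_add_nat[of 0 k] by (simp add: power_add[symmetric] add.commute)
  finally show ?case
    unfolding add_Suc_right sum.atMost_Suc_shift .
qed

text \<open>
  The derivative at \<open>z = -1\<close> of the triple product, whose only factor vanishing there is
  \<open>z + q\<^sup>0\<close>.
\<close>

lemma finite_Jacobi_cube:
  fixes q :: "'a::idom"
  shows "(-1) ^ m * qpoch q (Suc m) * qpoch q m
    = (\<Sum>j\<le>2 * Suc m. of_nat j * (-1) ^ (j - 1) * (qbinom q (2 * Suc m) j * q ^ tri (int j - int (Suc m))))"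
proof -
  let ?z = "[:0, 1:] :: 'a poly" and ?M = "Suc m"
  let ?c = "\<lambda>j. qbinom q (2 * ?M) j * q ^ tri (int j - int ?M)"
  \<comment> \<open>The product without its factor z + 1, so that the derivative of (z + 1) p at -1
    is p(-1).\<close>
  define p where "p = (\<Prod>i<?M. 1 + ?z * [:q:] ^ Suc i) * (\<Prod>i<m. ?z + [:q:] ^ Suc i)"
  have const: "[:q:] ^ i = [:q ^ i:]" for i
    by (induction i) auto
  have const_mult: "[:a:] * [:b:] * p = smult (a * b) p" for a b :: 'a and p
    by (simp add: mult.commute)
  have qb: "qbinom [:q:] n k = [:qbinom q n k:]" for n k
    by (rule qbinom_hom[symmetric]) simp_all
  have "(?z + 1) * p = (\<Prod>i<?M. 1 + ?z * [:q:] ^ Suc i) * (\<Prod>i<?M. ?z + [:q:] ^ i)"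
    unfolding p_def prod.lessThan_Suc_shift[of "\<lambda>i. ?z + [:q:] ^ i"] by (simp only: power_0 ac_simps)
  also have "\<dots> = (\<Sum>j\<le>?M + ?M. monom (?c j) j)"
    unfolding finite_Jacobi_triple_product
    unfolding qb const monom_altdef mult_2[symmetric] const_mult ..
  finally have "poly (pderiv ((?z + 1) * p)) (-1) = poly (pderiv (\<Sum>j\<le>2 * ?M. monom (?c j) j)) (-1)"
    by (simp only: mult_2)
  moreover have "poly (pderiv ((?z + 1) * p)) (-1) = poly p (-1)"
    by (simp add: pderiv_mult pderiv_add pderiv_pCons)
  moreover have "poly p (-1) = qpoch q ?M * (\<Prod>i<m. (-1) * (1 - q ^ Suc i))"
    by (simp add: p_def poly_prod qpoch_def const del: power_Suc prod.lessThan_Suc)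
  moreover have "(\<Prod>i<m. (-1) * (1 - q ^ Suc i)) = (-1) ^ m * qpoch q m"
    unfolding prod.distrib qpoch_def by simp
  \<comment> \<open>At j = 0 the exponent j - 1 is truncated, but the weight j is 0.\<close>
  moreover have "poly (pderiv (\<Sum>j\<le>2 * ?M. monom (?c j) j)) (-1)
      = (\<Sum>j\<le>2 * ?M. of_nat j * (-1) ^ (j - 1) * ?c j)"
    by (simp add: higher_pderiv_sum[of 1, simplified] poly_sum pderiv_monom poly_monom ac_simps
        del: qbinom.simps power_Suc sum.atMost_Suc mult_Suc_right of_nat_Suc)
  ultimately show ?thesis by (simp only: ac_simps)
qed

section \<open>Truncation modulo powers of q\<close>

lemma dvd_diff_mult:
  fixes a :: "'a::comm_ring_1"
  assumes "a dvd x - y" "a dvd u - v"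
  shows "a dvd x * u - y * v"
proof -
  have "x * u - y * v = (x - y) * u + y * (u - v)" by (simp add: algebra_simps)
  with assms show ?thesis by simp
qed

lemma dvd_diff_sum:
  fixes f g :: "'b \<Rightarrow> 'a::comm_ring_1"
  assumes "\<And>i. i \<in> S \<Longrightarrow> a dvd f i - g i"
  shows "a dvd sum f S - sum g S"
  unfolding sum_subtractf[symmetric] using assms by (rule dvd_sum)

lemma fps_nth_eq_if_X_power_dvd:
  fixes f g :: "'a::comm_ring_1 fps"
  assumes "fps_X ^ K dvd f - g" "i < K"
  shows "f $ i = g $ i"
proof -
  from assms(1) obtain h where "f - g = fps_X ^ K * h" by (elim dvdE)
  then have "(f - g) $ i = 0" using assms(2) by (simp add: fps_X_power_mult_nth)
  then show ?thesis by simp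
qed

text \<open>The additional factors are 1 modulo q^K, so \<open>qpoch q K\<close> can stand for the
  infinite product.\<close>

lemma qpoch_dvd_diff:
  assumes "K \<le> n"
  shows "q ^ K dvd qpoch q n - qpoch q K"
  using assms
proof (induction n rule: dec_induct)
  case (step n)
  have "qpoch q (Suc n) - qpoch q K = (qpoch q n - qpoch q K) - qpoch q n * q ^ Suc n"
    unfolding qpoch_Suc by (simp add: algebra_simps)
  moreover have "q ^ K dvd q ^ Suc n" using step by (intro le_imp_power_dvd) simp
  ultimately show ?case using step by (metis dvd_diff dvd_mult)
qed simp

lemma qpoch_X_nth_0: "qpoch (fps_X :: int fps) n $ 0 = 1"
  by (induction n) (simp_all add: qpoch_def)

lemma tri_ge:
  assumes "int K < \<bar>n\<bar>"
  shows "K \<le> tri n"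
proof (cases "K = 0")
  case False
  have "2 * int K \<le> (int K + 1) * int K" using False by (simp add: mult_right_mono)
  also have "\<dots> \<le> n * (n + 1)"
  proof (cases "n \<ge> 0")
    case True
    then show ?thesis using assms by (intro mult_mono) auto
  next
    case False
    then have "(int K + 1) * int K \<le> (-n) * (-n - 1)" using assms by (intro mult_mono) auto
    then show ?thesis by (simp add: algebra_simps)
  qed
  finally show ?thesis unfolding double_tri[symmetric] by simp
qed simp

definition jtp_coeff :: "nat \<Rightarrow> nat \<Rightarrow> int fps" where
  "jtp_coeff m j = qbinom fps_X (2 * m) j * fps_X ^ tri (int j - int m)"

text \<open>If j and 2m - j are both at least K, all Pochhammer products in the quotient formula
  agree with that of length K modulo q^K. Otherwise j is farther than K from m, and the power of q
  alone is divisible by q^K.\<close>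

lemma jtp_coeff_dvd_diff:
  assumes "2 * K < m" "j \<le> 2 * m"
  shows "fps_X ^ K dvd jtp_coeff m j * qpoch fps_X K - fps_X ^ tri (int j - int m)"
proof (cases "K \<le> j \<and> K \<le> 2 * m - j")
  case True
  let ?Q = "qpoch (fps_X :: int fps)" and ?b = "qbinom (fps_X :: int fps) (2 * m) j"
  \<comment> \<open>The inverse cancels one of the two factors \<open>?Q K\<close> that the quotient
    formula leaves.\<close>
  define V where "V = fps_right_inverse (?Q K) 1"
  have V: "?Q K * V = 1"
    unfolding V_def by (rule fps_right_inverse) (simp add: qpoch_X_nth_0)
  have "?b * ?Q j * ?Q (2 * m - j) = ?Q (2 * m)"
    using qbinom_mult_qpoch[of fps_X j "2 * m - j"] assms by simp
  then have "?b * ?Q K * ?Q K - ?Q K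
      = (?Q (2 * m) - ?Q K) - ?b * (?Q j * ?Q (2 * m - j) - ?Q K * ?Q K)"
    by (simp add: algebra_simps)
  moreover have "fps_X ^ K dvd ?Q (2 * m) - ?Q K"
    using assms by (intro qpoch_dvd_diff) simp
  moreover have "fps_X ^ K dvd ?Q j * ?Q (2 * m - j) - ?Q K * ?Q K"
    using True by (intro dvd_diff_mult qpoch_dvd_diff) auto
  ultimately have "fps_X ^ K dvd ?b * ?Q K * ?Q K - ?Q K"
    by (metis dvd_diff dvd_mult)
  then have "fps_X ^ K dvd (?b * ?Q K * ?Q K - ?Q K) * (V * fps_X ^ tri (int j - int m))"
    by (rule dvd_mult2)
  also have "(?b * ?Q K * ?Q K - ?Q K) * (V * fps_X ^ tri (int j - int m))
      = (?b * ?Q K * (?Q K * V) - ?Q K * V) * fps_X ^ tri (int j - int m)"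
    by (simp only: algebra_simps)
  also have "\<dots> = jtp_coeff m j * ?Q K - fps_X ^ tri (int j - int m)"
    unfolding V jtp_coeff_def by (simp add: algebra_simps)
  finally show ?thesis .
next
  case False
  then have "K \<le> tri (int j - int m)" using assms by (intro tri_ge) auto
  then have "fps_X ^ K dvd (fps_X ^ tri (int j - int m) :: int fps)"
    by (rule le_imp_power_dvd)
  then show ?thesis unfolding jtp_coeff_def by (intro dvd_diff dvd_mult2 dvd_mult)
qed

section \<open>Extraction of the coefficient of z^-1\<close>

definition fps_embed :: "int fps \<Rightarrow> int fls fps" where
  "fps_embed f = Abs_fps (\<lambda>n. fls_const (f $ n))"

lemma fls_const_sum: "fls_const (sum f S) = (\<Sum>i\<in>S. fls_const (f i))"
  by (induction S rule: infinite_finite_induct) (simp_all add: fls_plus_const[symmetric])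

lemma fps_embed_simps:
  "fps_embed (f + g) = fps_embed f + fps_embed g"
  "fps_embed (f * g) = fps_embed f * fps_embed g"
  "fps_embed 1 = 1" "fps_embed 0 = 0" "fps_embed fps_X = fps_X"
  by (simp_all add: fps_embed_def fps_eq_iff fps_mult_nth fls_const_sum fls_plus_const fps_X_def)

lemma fps_embed_power: "fps_embed (f ^ n) = fps_embed f ^ n"
  by (induction n) (simp_all add: fps_embed_simps)

text \<open>
  Up to the factor \<open>z\<^sup>2\<^sup>m\<close>, the partial product is the square of
  \<open>\<Sum>\<^sub>j jtp_coeff m j z\<^sup>j\<close>, so the coefficient of \<open>z\<^sup>-\<^sup>1\<close> collects the pairs with \<open>i + j = 2m - 1\<close>.
\<close>

definition neg1_pairs :: "nat \<Rightarrow> (nat \<times> nat) set" where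
  "neg1_pairs m = {p \<in> {..2 * m} \<times> {..2 * m}. fst p + snd p + 1 = 2 * m}"

lemma cphi_2_neg1_eq_sum:
  assumes "n < m"
  shows "cphi_2_neg1 n = (\<Sum>(i, j)\<in>neg1_pairs m. jtp_coeff m i * jtp_coeff m j) $ n"
proof -
  let ?z = "fps_const fls_X :: int fls fps" and ?q = "fps_X :: int fls fps"
  let ?P = "\<Prod>l<m. frob_factor l" and ?c = "\<lambda>j. fps_embed (jtp_coeff m j)"
  have z: "?z * fps_const fls_X_inv = 1"
    by (simp add: fls_X_times_conv_shift)
  \<comment> \<open>Multiplying by z^2 clears the inverse of z and exposes the factors of the finite
    triple product.\<close>
  have "frob_factor l * ?z\<^sup>2 = ((1 + ?z * ?q ^ Suc l) * (?z + ?q ^ l))\<^sup>2" for l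
  proof -
    have "frob_factor l * ?z\<^sup>2
        = ((1 + ?z * ?q ^ Suc l) * (?z + (?z * fps_const fls_X_inv) * ?q ^ l))\<^sup>2"
      unfolding frob_factor_def power_mult_distrib[symmetric] Suc_eq_plus1
      by (simp only: algebra_simps mult_1_right mult_1_left)
    then show ?thesis unfolding z by simp
  qed
  then have "?P * (?z\<^sup>2) ^ m = ((\<Prod>l<m. 1 + ?z * ?q ^ Suc l) * (\<Prod>l<m. ?z + ?q ^ l))\<^sup>2"
    unfolding prod.distrib[symmetric] prod_power_distrib
    by (metis (no_types, lifting) card_lessThan prod.cong prod.distrib prod_constant)
  also have "(\<Prod>l<m. 1 + ?z * ?q ^ Suc l) * (\<Prod>l<m. ?z + ?q ^ l) = (\<Sum>j\<le>2 * m. ?c j * ?z ^ j)"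
    unfolding finite_Jacobi_triple_product jtp_coeff_def fps_embed_simps fps_embed_power
    by (subst qbinom_hom[of fps_embed]) (simp_all add: fps_embed_simps mult_2)
  also have "\<dots>\<^sup>2 = (\<Sum>(i, j)\<in>{..2 * m} \<times> {..2 * m}. fps_embed (jtp_coeff m i * jtp_coeff m j) * ?z ^ (i + j))"
    unfolding power2_eq_square sum_product sum.cartesian_product fps_embed_simps power_add
    by (simp only: ac_simps)
  finally have *: "?P * ?z ^ (2 * m)
      = (\<Sum>(i, j)\<in>{..2 * m} \<times> {..2 * m}. fps_embed (jtp_coeff m i * jtp_coeff m j) * ?z ^ (i + j))"
    unfolding power_mult .
  have coeff: "fls_nth ((F * ?z ^ k) $ n) r = fls_nth (F $ n) (r - int k)" for F k r
    by (simp add: fps_const_power fls_X_power_times_conv_shift)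
  \<comment> \<open>Since n < m, the factors of index m and above do not affect the coefficient of
    q^n.\<close>
  have "cphi_2_neg1 n = fls_nth (?P $ n) (-1)"
    using frob_partial_stable[of n "m - 1"] assms
    by (cases m) (simp_all add: cphi_2_neg1_eq_partial lessThan_Suc_atMost)
  also have "\<dots> = fls_nth ((?P * ?z ^ (2 * m)) $ n) (2 * int m - 1)"
    unfolding coeff by simp
  also have "\<dots> = (\<Sum>(i, j)\<in>{..2 * m} \<times> {..2 * m}.
      fls_nth (fps_embed (jtp_coeff m i * jtp_coeff m j) $ n) (2 * int m - 1 - int (i + j)))"
    unfolding * fps_sum_nth fls_nth_sum case_prod_unfold coeff ..
  \<comment> \<open>Embedded series are constant in z, so only pairs with z-exponent 2m - 1
    survive.\<close>
  also have "\<dots> = (\<Sum>p\<in>{..2 * m} \<times> {..2 * m}.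
      if fst p + snd p + 1 = 2 * m then (jtp_coeff m (fst p) * jtp_coeff m (snd p)) $ n else 0)"
    unfolding case_prod_unfold
    by (rule sum.cong) (auto simp: fps_embed_def)
  also have "\<dots> = (\<Sum>(i, j)\<in>neg1_pairs m. jtp_coeff m i * jtp_coeff m j) $ n"
    unfolding neg1_pairs_def fps_sum_nth case_prod_unfold
    by (subst sum.inter_filter) simp_all
  finally show ?thesis .
qed

section \<open>Arithmetic modulo 5\<close>

lemma qpoch_power5_mod_5:
  "\<exists>D H. qpoch (fps_X :: int fps) n ^ 5 = D + 5 * H \<and> D $ 0 = 1 \<and> (\<forall>k. \<not> 5 dvd k \<longrightarrow> D $ k = 0)"
proof (induction n)
  case 0
  show ?case by (rule exI[of _ 1], rule exI[of _ 0]) (auto simp: qpoch_def)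
next
  case (Suc n)
  then obtain D H where DH: "qpoch (fps_X :: int fps) n ^ 5 = D + 5 * H" "D $ 0 = 1"
    "\<And>k. \<not> 5 dvd k \<Longrightarrow> D $ k = 0" by blast
  define x :: "int fps" where "x = fps_X ^ Suc n"
  \<comment> \<open>The inner terms of the expansion of (1 - x)^5, divided by 5.\<close>
  define h where "h = - x + 2 * x ^ 2 - 2 * x ^ 3 + x ^ 4"
  have frob: "(1 - x) ^ 5 = (1 - x ^ 5) + 5 * h"
    unfolding h_def by algebra
  have "qpoch fps_X (Suc n) ^ 5 = (D + 5 * H) * ((1 - x ^ 5) + 5 * h)"
    unfolding qpoch_Suc power_mult_distrib DH(1) frob[symmetric] by (simp only: x_def)
  also have "\<dots> = D * (1 - x ^ 5) + 5 * (D * h + H * ((1 - x ^ 5) + 5 * h))"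
    by (simp add: algebra_simps)
  finally have 1: "qpoch fps_X (Suc n) ^ 5 = D * (1 - x ^ 5) + 5 * (D * h + H * ((1 - x ^ 5) + 5 * h))" .
  have nth: "(D * (1 - x ^ 5)) $ k = D $ k - (if k < 5 * Suc n then 0 else D $ (k - 5 * Suc n))" for k
    unfolding x_def power_mult[symmetric] mult.commute[of "Suc n" 5] right_diff_distrib mult_1_right
    by (simp only: fps_sub_nth fps_X_power_mult_right_nth)
  have "(D * (1 - x ^ 5)) $ 0 = 1" unfolding nth using DH by simp
  moreover have "(D * (1 - x ^ 5)) $ k = 0" if "\<not> 5 dvd k" for k
  proof -
    have "\<not> 5 dvd k - 5 * Suc n" if "\<not> k < 5 * Suc n"
      using that \<open>\<not> 5 dvd k\<close> by (metis dvd_diffD dvd_triv_left not_less)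
    then show ?thesis unfolding nth using DH that by simp
  qed
  ultimately show ?case using 1 by blast
qed

text \<open>Coefficient 5n+4 of A D is that of A plus multiples of earlier coefficients of A in the
  same residue class; strong induction removes these.\<close>

lemma dvd_nth_if_dvd_mult_nth:
  fixes A D :: "int fps"
  assumes "D $ 0 = 1" "\<And>k. \<not> 5 dvd k \<Longrightarrow> D $ k = 0"
    and "\<And>j. j \<le> n \<Longrightarrow> 5 dvd (A * D) $ (5 * j + 4)"
  shows "5 dvd A $ (5 * n + 4)"
  using assms(3)
proof (induction n rule: less_induct)
  case (less n)
  let ?N = "5 * n + 4"
  have "(A * D) $ ?N = (\<Sum>i<Suc ?N. A $ i * D $ (?N - i))"
    unfolding fps_mult_nth by (rule sum.cong) auto
  also have "\<dots> = (\<Sum>i<?N. A $ i * D $ (?N - i)) + A $ ?N"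
    unfolding sum.lessThan_Suc using assms(1) by simp
  finally have "A $ ?N = (A * D) $ ?N - (\<Sum>i<?N. A $ i * D $ (?N - i))" by simp
  moreover have "5 dvd (\<Sum>i<?N. A $ i * D $ (?N - i))"
  proof (rule dvd_sum)
    fix i assume i: "i \<in> {..<?N}"
    show "5 dvd A $ i * D $ (?N - i)"
    proof (cases "5 dvd ?N - i")
      case True
      then obtain t where t: "?N - i = 5 * t" by (elim dvdE)
      then have "i = 5 * (n - t) + 4" "n - t < n" using i by auto
      then show ?thesis using less by (metis dvd_mult2 le_trans less_imp_le)
    qed (simp add: assms(2))
  qed
  ultimately show ?case using less.prems[of n] by (simp add: dvd_diff)
qed

text \<open>
  The index \<open>k\<close> is the weight in \<open>finite_Jacobi_cube\<close>. With \<open>b = k - m\<close> and \<open>m \<equiv> 3 (mod 5)\<close>, one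
  has \<open>2k \<equiv> 2b + 1\<close>, which is the weight in Jacobi's identity; this is why \<open>m\<close> is chosen so.
\<close>

lemma five_dvd_of_tri_sum:
  fixes i j k m n :: nat
  assumes "i + j + 1 = 2 * m" "m mod 5 = 3"
    and "tri (int i - int m) + tri (int j - int m) + tri (int k - int m) = 5 * n + 4"
  shows "5 dvd k"
proof -
  define a where "a = int i - int m"
  define b where "b = int k - int m"
  \<comment> \<open>The two indices are related by the reflection a to -1 - a, which fixes
    a(a+1).\<close>
  have "int j - int m = - 1 - a" using assms(1) unfolding a_def by linarith
  then have "2 * (int (tri a) + int (tri (- 1 - a)) + int (tri b)) = 2 * (5 * int n + 4)"
    using assms(3) unfolding a_def b_def by (metis of_nat_add of_nat_mult of_nat_numeral)
  then have "2 * (a * (a + 1)) + b * (b + 1) = 10 * int n + 8"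
    using double_tri[of a] double_tri[of "- 1 - a"] double_tri[of b] by (simp add: algebra_simps)
  then have "(2 * (a * (a + 1)) + b * (b + 1)) mod 5 = 3" by presburger
  moreover have "[2 * (a * (a + 1)) + b * (b + 1)
      = 2 * ((a mod 5) * (a mod 5 + 1)) + (b mod 5) * (b mod 5 + 1)] (mod 5)"
    by (intro cong_add cong_mult cong_refl) (simp_all add: cong_def)
  moreover have "a mod 5 \<in> {0, 1, 2, 3, 4}" "b mod 5 \<in> {0, 1, 2, 3, 4}" by auto
  \<comment> \<open>Among the 25 residue pairs only a = b = 2 gives the value 3.\<close>
  ultimately have "b mod 5 = 2" by (auto simp: cong_def)
  then show ?thesis using assms(2) unfolding b_def by presburger
qed

theorem theorem6:
  fixes n :: nat
  shows "[cphi_2_neg1 (5 * n + 4) = 0] (mod 5)"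
proof -
  \<comment> \<open>K exceeds every coefficient index needed, \<open>m'\<close> is even to remove
    the sign (-1)^m' of the cube identity, and m = 10K + 3 is 3 modulo 5.\<close>
  define K m' m where "K = 5 * n + 5" and "m' = 10 * K + 2" and "m = Suc m'"
  define E :: "int fps" where "E = qpoch fps_X K"
  define A where "A = (\<Sum>(i, j)\<in>neg1_pairs m. jtp_coeff m i * jtp_coeff m j)"
  define T where "T = (\<lambda>j. tri (int j - int m))"
  define B :: "int fps" where "B = (\<Sum>(i, j)\<in>neg1_pairs m. fps_X ^ T i * fps_X ^ T j)"
  define w :: "nat \<Rightarrow> int fps" where "w k = of_nat k * (-1) ^ (k - 1)" for k
  \<comment> \<open>This will be (q;q)^3 modulo q^K; pairing k with 2m - 1 - k gives Jacobi's
    weights 2b + 1.\<close>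
  define C where "C = (\<Sum>k\<le>2 * m. w k * fps_X ^ T k)"
  have m: "2 * K < m" "m mod 5 = 3" "even m'" unfolding m_def m'_def by presburger+
  have coeff: "fps_X ^ K dvd jtp_coeff m j * E - fps_X ^ T j" if "j \<le> 2 * m" for j
    unfolding E_def T_def using m(1) that by (rule jtp_coeff_dvd_diff)
  have "A * E ^ 2 = (\<Sum>(i, j)\<in>neg1_pairs m. (jtp_coeff m i * E) * (jtp_coeff m j * E))"
    unfolding A_def sum_distrib_right case_prod_unfold power2_eq_square by (simp only: ac_simps)
  also have "fps_X ^ K dvd \<dots> - B"
    unfolding B_def case_prod_unfold
    by (intro dvd_diff_sum dvd_diff_mult coeff) (auto simp: neg1_pairs_def)
  finally have AB: "fps_X ^ K dvd A * E ^ 2 - B" .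
  have "qpoch fps_X m * qpoch fps_X m' = (\<Sum>k\<le>2 * m. w k * jtp_coeff m k)"
    using finite_Jacobi_cube[of m' "fps_X :: int fps"] m(3)
    unfolding m_def jtp_coeff_def w_def by simp
  then have "qpoch fps_X m * qpoch fps_X m' * E = (\<Sum>k\<le>2 * m. w k * (jtp_coeff m k * E))"
    by (simp only: sum_distrib_right mult.assoc)
  also have "fps_X ^ K dvd \<dots> - C"
    unfolding C_def by (intro dvd_diff_sum dvd_diff_mult coeff) auto
  finally have C: "fps_X ^ K dvd qpoch fps_X m * qpoch fps_X m' * E - C" .
  have "fps_X ^ K dvd qpoch fps_X m * qpoch fps_X m' * E - E * E * E"
    unfolding E_def by (intro dvd_diff_mult qpoch_dvd_diff) (auto simp: m_def m'_def)
  from dvd_diff[OF C this] have EC: "fps_X ^ K dvd E ^ 3 - C"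
    by (simp add: power3_eq_cube)
  have ABC: "fps_X ^ K dvd A * E ^ 5 - B * C"
    using dvd_diff_mult[OF AB EC] by (simp add: mult.assoc power_add[symmetric])
  have BC: "5 dvd (B * C) $ (5 * j + 4)" for j
  proof -
    have "B * C = (\<Sum>p\<in>neg1_pairs m. \<Sum>k\<le>2 * m.
        fps_const (int k * (-1) ^ (k - 1)) * fps_X ^ (T (fst p) + T (snd p) + T k))"
      unfolding B_def C_def w_def case_prod_unfold sum_product power_add
      by (simp add: fps_of_nat[symmetric] fps_const_power[symmetric] ac_simps flip: fps_const_mult fps_const_neg)
    moreover have "5 dvd (fps_const (int k * (-1) ^ (k - 1)) * fps_X ^ (T (fst p) + T (snd p) + T k)) $ (5 * j + 4)"
      if "p \<in> neg1_pairs m" for p k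
    proof (cases "T (fst p) + T (snd p) + T k = 5 * j + 4")
      case True
      then have "5 dvd k"
        using five_dvd_of_tri_sum[of "fst p" "snd p" m k j] that m(2)
        unfolding T_def neg1_pairs_def by auto
      then have "5 dvd int k" by presburger
      then show ?thesis by (simp add: fps_X_power_iff)
    next
      case False
      then show ?thesis by (simp add: fps_X_power_iff)
    qed
    ultimately show ?thesis by (auto simp: fps_sum_nth intro!: dvd_sum)
  qed
  obtain D H where DH: "E ^ 5 = D + 5 * H" "D $ 0 = 1" "\<And>k. \<not> 5 dvd k \<Longrightarrow> D $ k = 0"
    using qpoch_power5_mod_5[of K] unfolding E_def by blast
  have "5 dvd A $ (5 * n + 4)"
  proof (rule dvd_nth_if_dvd_mult_nth[OF DH(2,3)])
    fix j assume "j \<le> n"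
    \<comment> \<open>The truncated identity applies because 5j + 4 < K for j \<le> n.\<close>
    then have "(A * E ^ 5) $ (5 * j + 4) = (B * C) $ (5 * j + 4)"
      using ABC by (intro fps_nth_eq_if_X_power_dvd[of K]) (auto simp: K_def)
    moreover have "A * E ^ 5 = A * D + fps_const 5 * (A * H)"
      unfolding DH(1) by (simp add: algebra_simps numeral_fps_const)
    ultimately have "(A * D) $ (5 * j + 4) = (B * C) $ (5 * j + 4) - 5 * (A * H) $ (5 * j + 4)"
      by simp
    then show "5 dvd (A * D) $ (5 * j + 4)" using BC[of j] by simp
  qed
  moreover have "cphi_2_neg1 (5 * n + 4) = A $ (5 * n + 4)"
    unfolding A_def by (rule cphi_2_neg1_eq_sum) (simp add: m_def m'_def K_def)
  ultimately show ?thesis by (simp add: cong_0_iff)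
qed

end
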